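(* Let $L$ be a frame. Then a canonical extension $e\colon L\to L^\delta$ of $L$ exists, and it is uniquely determined up to isomorphism (that is, if $e\colon L\to C$ and $e'\colon L\to C'$ are both canonical extensions of $L$, then there is an isomorphism of complete lattices $\iota\colon C'\to C$ with $\iota\circ e'=e$). Moreover $L^\delta\cong \mathscr{G}(L^{\wedge}, L, Z)$, where $Z\subseteq L^{\wedge}\times L$ is the relation given by $\kappa\, Z\, a$ iff $a\in\kappa$.
   Context: A frame is a complete lattice $L$ satisfying $(\bigvee A)\wedge b=\bigvee_{a\in A}(a\wedge b)$ for all $A\subseteq L$, $b\in L$. A filter of $L$ is an upset closed under finite meets (so it contains $1$; the improper filter $L$ is allowed). A filter $\kappa\subseteq L$ is Scott-open if, whenever $D\subseteq L$ is directed and $\bigvee D\in\kappa$, then $d\in\kappa$ for some $d\in D$. $L^{\wedge}$ denotes the set of Scott-open filters of $L$, ordered by reverse inclusion. A canonical extension of $L$ is a monotone map $e\colon L\to L^\delta$ into a complete lattice $L^\delta$ such that: (Dense) for all $u,v\in L^\delta$: $u\le v$ holds provided that for all $\kappa\in L^{\wedge}$ and $a\in L$, the inequalities $\bigwedge e[\kappa]\le u$ and $v\le e(a)$ together imply $\bigwedge e[\kappa]\le e(a)$; (Compact) if $\bigwedge e[\kappa]\le e(a)$ for some $\kappa\in L^{\wedge}$ and $a\in L$, then $a\in\kappa$. Here $e[\kappa]=\{e(b)\mid b\in\kappa\}$. For sets $X,Y$ and a relation $Z\subseteq X\times Y$, define $p\colon \mathcal P(X)\to\mathcal P(Y)$,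 $p(M)=\{y\in Y\mid \forall x\in M,\ xZy\}$ and $q\colon \mathcal P(Y)\to\mathcal P(X)$, $q(N)=\{x\in X\mid \forall y\in N,\ xZy\}$. Then $q\circ p$ is a closure operator on $\mathcal P(X)$, and $\mathscr{G}(X,Y,Z)$ is the complete lattice of all $M\subseteq X$ with $q(p(M))=M$, ordered by inclusion. *)

theory Defs
  imports "HOL-Algebra.Complete_Lattice"
begin

locale frame = complete_lattice L for L (structure) +
  assumes sup_meet_distrib:
    "\<lbrakk>A \<subseteq> carrier L; b \<in> carrier L\<rbrakk> \<Longrightarrow> (\<Squnion>A) \<sqinter> b = \<Squnion>((\<lambda>a. a \<sqinter> b) ` A)"

(* Finite meets include the empty one, so a filter contains the top element; the improper
   filter carrier L is allowed. *)
definition lattice_filter :: "('a, 'm) gorder_scheme \<Rightarrow> 'a set \<Rightarrow> bool" where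
  "lattice_filter L F \<longleftrightarrow>
     F \<subseteq> carrier L \<and>
     (\<forall>x\<in>F. \<forall>y\<in>carrier L. x \<sqsubseteq>\<^bsub>L\<^esub> y \<longrightarrow> y \<in> F) \<and>
     (\<forall>A\<subseteq>F. finite A \<longrightarrow> \<Sqinter>\<^bsub>L\<^esub>A \<in> F)"

(* Directed sets are nonempty; otherwise the improper filter would not be Scott-open. *)
definition directed_subset :: "('a, 'm) gorder_scheme \<Rightarrow> 'a set \<Rightarrow> bool" where
  "directed_subset L D \<longleftrightarrow>
     D \<subseteq> carrier L \<and> D \<noteq> {} \<and> (\<forall>x\<in>D. \<forall>y\<in>D. \<exists>z\<in>D. x \<sqsubseteq>\<^bsub>L\<^esub> z \<and> y \<sqsubseteq>\<^bsub>L\<^esub> z)"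

definition scott_open :: "('a, 'm) gorder_scheme \<Rightarrow> 'a set \<Rightarrow> bool" where
  "scott_open L K \<longleftrightarrow> (\<forall>D. directed_subset L D \<and> \<Squnion>\<^bsub>L\<^esub>D \<in> K \<longrightarrow> (\<exists>d\<in>D. d \<in> K))"

definition scott_open_filters :: "('a, 'm) gorder_scheme \<Rightarrow> 'a set set" where
  "scott_open_filters L = {K. lattice_filter L K \<and> scott_open L K}"

definition canonical_extension ::
  "('a, 'm) gorder_scheme \<Rightarrow> ('c, 'n) gorder_scheme \<Rightarrow> ('a \<Rightarrow> 'c) \<Rightarrow> bool" where
  "canonical_extension L C e \<longleftrightarrow>
     complete_lattice C \<and> e \<in> carrier L \<rightarrow> carrier C \<and> isotone L C e \<and>
     \<comment> \<open>Dense\<close>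
     (\<forall>u\<in>carrier C. \<forall>v\<in>carrier C.
        (\<forall>K\<in>scott_open_filters L. \<forall>a\<in>carrier L.
           \<Sqinter>\<^bsub>C\<^esub>(e ` K) \<sqsubseteq>\<^bsub>C\<^esub> u \<and> v \<sqsubseteq>\<^bsub>C\<^esub> e a \<longrightarrow> \<Sqinter>\<^bsub>C\<^esub>(e ` K) \<sqsubseteq>\<^bsub>C\<^esub> e a)
        \<longrightarrow> u \<sqsubseteq>\<^bsub>C\<^esub> v) \<and>
     \<comment> \<open>Compact\<close>
     (\<forall>K\<in>scott_open_filters L. \<forall>a\<in>carrier L. \<Sqinter>\<^bsub>C\<^esub>(e ` K) \<sqsubseteq>\<^bsub>C\<^esub> e a \<longrightarrow> a \<in> K)"

(* sup_pres and inf_pres also require A and B to be complete lattices. *)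
definition complete_lattice_iso ::
  "('c, 'm) gorder_scheme \<Rightarrow> ('d, 'n) gorder_scheme \<Rightarrow> ('c \<Rightarrow> 'd) \<Rightarrow> bool" where
  "complete_lattice_iso A B f \<longleftrightarrow>
     bij_betw f (carrier A) (carrier B) \<and> sup_pres A B f \<and> inf_pres A B f"

definition polar_right :: "'y set \<Rightarrow> ('x \<times> 'y) set \<Rightarrow> 'x set \<Rightarrow> 'y set" where
  "polar_right Y Z M = {y \<in> Y. \<forall>x\<in>M. (x, y) \<in> Z}"

definition polar_left :: "'x set \<Rightarrow> ('x \<times> 'y) set \<Rightarrow> 'y set \<Rightarrow> 'x set" where
  "polar_left X Z N = {x \<in> X. \<forall>y\<in>N. (x, y) \<in> Z}"

definition galois_lattice :: "'x set \<Rightarrow> 'y set \<Rightarrow> ('x \<times> 'y) set \<Rightarrow> 'x set gorder" where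
  "galois_lattice X Y Z =
     \<lparr>carrier = {M. M \<subseteq> X \<and> polar_left X Z (polar_right Y Z M) = M}, eq = (=), le = (\<subseteq>)\<rparr>"

lemma galois_lattice_complete: "complete_lattice (galois_lattice X Y Z)"
proof -
  let ?G = "galois_lattice X Y Z"
  let ?cl = "\<lambda>M. polar_left X Z (polar_right Y Z M)"
  have sub: "?cl M \<subseteq> X" for M
    by (auto simp: polar_left_def)
  have ext: "M \<subseteq> ?cl M" if "M \<subseteq> X" for M
    using that by (auto simp: polar_left_def polar_right_def)
  have mono: "?cl M \<subseteq> ?cl N" if "M \<subseteq> N" for M N
    using that by (auto simp: polar_left_def polar_right_def)
  have idem: "?cl (?cl M) = ?cl M" for M
    by (auto simp: polar_left_def polar_right_def)
  have car: "M \<in> carrier ?G \<longleftrightarrow> M \<subseteq> X \<and> ?cl M = M" for M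
    by (simp add: galois_lattice_def)
  have le: "le ?G = (\<subseteq>)" and eq: "eq ?G = (=)"
    by (simp_all add: galois_lattice_def)
  show ?thesis
  proof
    fix A assume A: "A \<subseteq> carrier ?G"
    have U: "\<Union>A \<subseteq> X"
      using A car by blast
    have "least ?G (?cl (\<Union>A)) (Upper ?G A)"
      unfolding least_def Upper_def le
    proof (intro conjI ballI)
      show "?cl (\<Union>A) \<in> {u. \<forall>x. x \<in> A \<inter> carrier ?G \<longrightarrow> x \<subseteq> u} \<inter> carrier ?G"
        using ext[OF U] sub idem by (auto simp: car)
      fix B assume "B \<in> {u. \<forall>x. x \<in> A \<inter> carrier ?G \<longrightarrow> x \<subseteq> u} \<inter> carrier ?G"
      then have "\<Union>A \<subseteq> B" "?cl B = B"
        using A car by blast+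
      then show "?cl (\<Union>A) \<subseteq> B"
        using mono[of "\<Union>A" B] by simp
    qed auto
    then show "\<exists>s. least ?G s (Upper ?G A)" ..
    let ?I = "X \<inter> \<Inter>A"
    have "?cl ?I \<subseteq> M" if "M \<in> A" for M
    proof -
      have "?I \<subseteq> M"
        using that by blast
      from mono[OF this] show ?thesis
        using A that car by blast
    qed
    then have "?cl ?I = ?I"
      using sub[of ?I] ext[of ?I] by blast
    then have I: "?I \<in> carrier ?G"
      by (simp add: car)
    have "greatest ?G ?I (Lower ?G A)"
      unfolding greatest_def Lower_def le
    proof (intro conjI ballI)
      show "?I \<in> {l. \<forall>x. x \<in> A \<inter> carrier ?G \<longrightarrow> l \<subseteq> x} \<inter> carrier ?G"
        using I by auto
      fix B assume "B \<in> {l. \<forall>x. x \<in> A \<inter> carrier ?G \<longrightarrow> l \<subseteq> x} \<inter> carrier ?G"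
      then show "B \<subseteq> ?I"
        using A car by blast
    qed auto
    then show "\<exists>i. greatest ?G i (Lower ?G A)" ..
  qed (auto simp: le eq)
qed

end

(* A canonical extension C is determined by the incidence relation between the meets of e[K]
   (K a Scott-open filter) and the elements e(a): density makes both families order-determining,
   and compactness says that the meet of e[K] lies below e(a) exactly when a is in K. Hence
   u |-> {K. meet of e[K] is below u} is an order isomorphism from C onto the Galois closed sets
   of scott_open_filters L, under which e(a) corresponds to {K. a in K}. Conversely, a |-> {K. a in K}
   is a canonical extension with values in the lattice of Galois closed sets. *)
theory Submission
  imports Defs
begin

lemma complete_lattice_isoI:
  assumes A: "complete_lattice A" and B: "complete_lattice B"
    and bij: "bij_betw f (carrier A) (carrier B)"
    and le: "\<And>x y. x \<in> carrier A \<Longrightarrow> y \<in> carrier A \<Longrightarrow> f x \<sqsubseteq>\<^bsub>B\<^esub> f y \<longleftrightarrow> x \<sqsubseteq>\<^bsub>A\<^esub> y"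
  shows "complete_lattice_iso A B f"
proof -
  interpret A: complete_lattice A by fact
  interpret B: complete_lattice B by fact
  have f: "f x \<in> carrier B" if "x \<in> carrier A" for x
    using bij that by (auto simp: bij_betw_def)
  have surj: "\<exists>x\<in>carrier A. y = f x" if "y \<in> carrier B" for y
    using bij that by (auto simp: bij_betw_def)
  have "f (\<Squnion>\<^bsub>A\<^esub>S) = \<Squnion>\<^bsub>B\<^esub>(f ` S)" and "f (\<Sqinter>\<^bsub>A\<^esub>S) = \<Sqinter>\<^bsub>B\<^esub>(f ` S)" if S: "S \<subseteq> carrier A" for S
  proof -
    have fS: "f ` S \<subseteq> carrier B"
      using S f by blast
    obtain s where s: "s \<in> carrier A" "\<Squnion>\<^bsub>B\<^esub>(f ` S) = f s"
      using surj B.sup_closed[OF fS] by blast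
    obtain t where t: "t \<in> carrier A" "\<Sqinter>\<^bsub>B\<^esub>(f ` S) = f t"
      using surj B.inf_closed[OF fS] by blast
    have "x \<sqsubseteq>\<^bsub>A\<^esub> s" if "x \<in> S" for x
      using B.sup_upper[OF fS, of "f x"] that S s le by auto
    then have "\<Squnion>\<^bsub>A\<^esub>S \<sqsubseteq>\<^bsub>A\<^esub> s"
      using A.sup_least[OF S s(1)] by blast
    then have 1: "f (\<Squnion>\<^bsub>A\<^esub>S) \<sqsubseteq>\<^bsub>B\<^esub> \<Squnion>\<^bsub>B\<^esub>(f ` S)"
      using s le A.sup_closed[OF S] by simp
    have "f x \<sqsubseteq>\<^bsub>B\<^esub> f (\<Squnion>\<^bsub>A\<^esub>S)" if "x \<in> S" for x
      using A.sup_upper[OF S that] A.sup_closed[OF S] that S le by blast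
    then have 2: "\<Squnion>\<^bsub>B\<^esub>(f ` S) \<sqsubseteq>\<^bsub>B\<^esub> f (\<Squnion>\<^bsub>A\<^esub>S)"
      using B.sup_least[OF fS f[OF A.sup_closed[OF S]]] by blast
    show "f (\<Squnion>\<^bsub>A\<^esub>S) = \<Squnion>\<^bsub>B\<^esub>(f ` S)"
      using B.le_antisym[OF 1 2] f A.sup_closed[OF S] B.sup_closed[OF fS] by blast
    have "t \<sqsubseteq>\<^bsub>A\<^esub> x" if "x \<in> S" for x
      using B.inf_lower[OF fS, of "f x"] that S t le by auto
    then have "t \<sqsubseteq>\<^bsub>A\<^esub> \<Sqinter>\<^bsub>A\<^esub>S"
      using A.inf_greatest[OF S t(1)] by blast
    then have 1: "\<Sqinter>\<^bsub>B\<^esub>(f ` S) \<sqsubseteq>\<^bsub>B\<^esub> f (\<Sqinter>\<^bsub>A\<^esub>S)"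
      using t le A.inf_closed[OF S] by simp
    have "f (\<Sqinter>\<^bsub>A\<^esub>S) \<sqsubseteq>\<^bsub>B\<^esub> f x" if "x \<in> S" for x
      using A.inf_lower[OF S that] A.inf_closed[OF S] that S le by blast
    then have 2: "f (\<Sqinter>\<^bsub>A\<^esub>S) \<sqsubseteq>\<^bsub>B\<^esub> \<Sqinter>\<^bsub>B\<^esub>(f ` S)"
      using B.inf_greatest[OF fS f[OF A.inf_closed[OF S]]] by blast
    show "f (\<Sqinter>\<^bsub>A\<^esub>S) = \<Sqinter>\<^bsub>B\<^esub>(f ` S)"
      using B.le_antisym[OF 2 1] f A.inf_closed[OF S] B.inf_closed[OF fS] by blast
  qed
  then show ?thesis
    using A B bij by (simp add: complete_lattice_iso_def sup_pres_def inf_pres_def)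
qed

section \<open>Scott-open filters and their incidence with elements of the frame\<close>

lemma scott_open_filters_carrier: "K \<in> scott_open_filters L \<Longrightarrow> K \<subseteq> carrier L"
  by (simp add: scott_open_filters_def lattice_filter_def)

lemma scott_open_filters_upset:
  "K \<in> scott_open_filters L \<Longrightarrow> a \<in> K \<Longrightarrow> b \<in> carrier L \<Longrightarrow> a \<sqsubseteq>\<^bsub>L\<^esub> b \<Longrightarrow> b \<in> K"
  by (auto simp: scott_open_filters_def lattice_filter_def)

text \<open>An abbreviation, so that results about it apply directly to the set comprehension for
  the relation Z in the final statement.\<close>

abbreviation filter_incidence :: "('a, 'm) gorder_scheme \<Rightarrow> ('a set \<times> 'a) set" where
  "filter_incidence L \<equiv> {(\<kappa>, a). \<kappa> \<in> scott_open_filters L \<and> a \<in> carrier L \<and> a \<in> \<kappa>}"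

abbreviation filter_galois_lattice :: "('a, 'm) gorder_scheme \<Rightarrow> 'a set set gorder" where
  "filter_galois_lattice L \<equiv>
     galois_lattice (scott_open_filters L) (carrier L) (filter_incidence L)"

definition filters_below ::
  "('a, 'm) gorder_scheme \<Rightarrow> ('c, 'n) gorder_scheme \<Rightarrow> ('a \<Rightarrow> 'c) \<Rightarrow> 'c \<Rightarrow> 'a set set" where
  "filters_below L C e u = {K \<in> scott_open_filters L. \<Sqinter>\<^bsub>C\<^esub>(e ` K) \<sqsubseteq>\<^bsub>C\<^esub> u}"

section \<open>Representation of an arbitrary canonical extension by Galois closed sets of
  filters\<close>

context
  fixes L :: "('a, 'm) gorder_scheme" and C :: "('c, 'n) gorder_scheme" and e
  assumes ext: "canonical_extension L C e"
begin

interpretation C: complete_lattice C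
  using ext by (simp add: canonical_extension_def)

lemma canonical_extension_closed: "a \<in> carrier L \<Longrightarrow> e a \<in> carrier C"
  using ext by (auto simp: canonical_extension_def)

lemma canonical_extension_image_closed: "K \<in> scott_open_filters L \<Longrightarrow> e ` K \<subseteq> carrier C"
  using canonical_extension_closed scott_open_filters_carrier by fast

lemma canonical_extension_inf_closed: "K \<in> scott_open_filters L \<Longrightarrow> \<Sqinter>\<^bsub>C\<^esub>(e ` K) \<in> carrier C"
  by (simp add: canonical_extension_image_closed)

text \<open>Compactness gives one direction; for the other, \<open>e a\<close> is one of the
  elements whose meet is taken. The right-hand side no longer mentions \<open>C\<close>, which is
  what makes different extensions comparable.\<close>

lemma canonical_extension_inf_le_iff:
  assumes K: "K \<in> scott_open_filters L" and a: "a \<in> carrier L"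
  shows "\<Sqinter>\<^bsub>C\<^esub>(e ` K) \<sqsubseteq>\<^bsub>C\<^esub> e a \<longleftrightarrow> a \<in> K"
proof
  assume "\<Sqinter>\<^bsub>C\<^esub>(e ` K) \<sqsubseteq>\<^bsub>C\<^esub> e a"
  then show "a \<in> K"
    using ext K a by (auto simp: canonical_extension_def)
next
  assume "a \<in> K"
  then show "\<Sqinter>\<^bsub>C\<^esub>(e ` K) \<sqsubseteq>\<^bsub>C\<^esub> e a"
    using C.inf_lower[OF canonical_extension_image_closed[OF K]] by blast
qed

lemma canonical_extension_dense:
  assumes "u \<in> carrier C" "v \<in> carrier C"
    and "\<And>K a. K \<in> scott_open_filters L \<Longrightarrow> a \<in> carrier L \<Longrightarrow>
           \<Sqinter>\<^bsub>C\<^esub>(e ` K) \<sqsubseteq>\<^bsub>C\<^esub> u \<Longrightarrow> v \<sqsubseteq>\<^bsub>C\<^esub> e a \<Longrightarrow> \<Sqinter>\<^bsub>C\<^esub>(e ` K) \<sqsubseteq>\<^bsub>C\<^esub> e a"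
  shows "u \<sqsubseteq>\<^bsub>C\<^esub> v"
proof -
  have "\<forall>u\<in>carrier C. \<forall>v\<in>carrier C.
      (\<forall>K\<in>scott_open_filters L. \<forall>a\<in>carrier L.
         \<Sqinter>\<^bsub>C\<^esub>(e ` K) \<sqsubseteq>\<^bsub>C\<^esub> u \<and> v \<sqsubseteq>\<^bsub>C\<^esub> e a \<longrightarrow> \<Sqinter>\<^bsub>C\<^esub>(e ` K) \<sqsubseteq>\<^bsub>C\<^esub> e a)
      \<longrightarrow> u \<sqsubseteq>\<^bsub>C\<^esub> v"
    using ext unfolding canonical_extension_def by (elim conjE)
  from this[rule_format, OF assms(1,2)] show ?thesis
    using assms(3) by simp
qed

lemma filters_below_subset_iff:
  assumes u: "u \<in> carrier C" and v: "v \<in> carrier C"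
  shows "filters_below L C e u \<subseteq> filters_below L C e v \<longleftrightarrow> u \<sqsubseteq>\<^bsub>C\<^esub> v"
proof
  assume sub: "filters_below L C e u \<subseteq> filters_below L C e v"
  show "u \<sqsubseteq>\<^bsub>C\<^esub> v"
  proof (rule canonical_extension_dense[OF u v])
    fix K a
    assume K: "K \<in> scott_open_filters L" and a: "a \<in> carrier L"
      and "\<Sqinter>\<^bsub>C\<^esub>(e ` K) \<sqsubseteq>\<^bsub>C\<^esub> u" and va: "v \<sqsubseteq>\<^bsub>C\<^esub> e a"
    then have "\<Sqinter>\<^bsub>C\<^esub>(e ` K) \<sqsubseteq>\<^bsub>C\<^esub> v"
      using sub by (auto simp: filters_below_def)
    from C.le_trans[OF this va] show "\<Sqinter>\<^bsub>C\<^esub>(e ` K) \<sqsubseteq>\<^bsub>C\<^esub> e a"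
      using canonical_extension_inf_closed[OF K] v canonical_extension_closed[OF a] .
  qed
next
  assume uv: "u \<sqsubseteq>\<^bsub>C\<^esub> v"
  show "filters_below L C e u \<subseteq> filters_below L C e v"
    using C.le_trans[OF _ uv canonical_extension_inf_closed u v] by (auto simp: filters_below_def)
qed

lemma filters_below_image: "a \<in> carrier L \<Longrightarrow> filters_below L C e (e a) = {K \<in> scott_open_filters L. a \<in> K}"
  by (auto simp: filters_below_def canonical_extension_inf_le_iff)

text \<open>By \<open>filters_below_subset_iff\<close>, comparing \<open>u\<close> with
  \<open>e a\<close> means comparing traces, and the trace of \<open>e a\<close> consists of the
  filters containing \<open>a\<close>. This is the first half of showing that traces are Galois
  closed.\<close>

lemma polar_right_filters_below:
  assumes u: "u \<in> carrier C"
  shows "polar_right (carrier L) (filter_incidence L) (filters_below L C e u)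
           = {a \<in> carrier L. u \<sqsubseteq>\<^bsub>C\<^esub> e a}"
proof -
  have X: "filters_below L C e u \<subseteq> scott_open_filters L"
    by (auto simp: filters_below_def)
  then have "u \<sqsubseteq>\<^bsub>C\<^esub> e a \<longleftrightarrow> (\<forall>K\<in>filters_below L C e u. a \<in> K)" if a: "a \<in> carrier L" for a
    unfolding filters_below_subset_iff[OF u canonical_extension_closed[OF a], symmetric]
      filters_below_image[OF a] by blast
  moreover have "polar_right (carrier L) (filter_incidence L) (filters_below L C e u)
      = {a \<in> carrier L. \<forall>K\<in>filters_below L C e u. a \<in> K}"
    using X unfolding polar_right_def by blast
  ultimately show ?thesis
    by (simp cong: conj_cong)
qed

lemma polar_left_above:
  assumes u: "u \<in> carrier C"
  shows "polar_left (scott_open_filters L) (filter_incidence L) {a \<in> carrier L. u \<sqsubseteq>\<^bsub>C\<^esub> e a}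
           = filters_below L C e u"
proof (intro equalityI subsetI)
  fix K
  assume "K \<in> polar_left (scott_open_filters L) (filter_incidence L) {a \<in> carrier L. u \<sqsubseteq>\<^bsub>C\<^esub> e a}"
  then have K: "K \<in> scott_open_filters L"
    and above: "\<And>a. a \<in> carrier L \<Longrightarrow> u \<sqsubseteq>\<^bsub>C\<^esub> e a \<Longrightarrow> a \<in> K"
    by (auto simp: polar_left_def)
  have "\<Sqinter>\<^bsub>C\<^esub>(e ` K) \<sqsubseteq>\<^bsub>C\<^esub> u"
  proof (rule canonical_extension_dense[OF canonical_extension_inf_closed[OF K] u])
    fix K' a
    assume K': "K' \<in> scott_open_filters L" and a: "a \<in> carrier L"
      and le: "\<Sqinter>\<^bsub>C\<^esub>(e ` K') \<sqsubseteq>\<^bsub>C\<^esub> \<Sqinter>\<^bsub>C\<^esub>(e ` K)" and "u \<sqsubseteq>\<^bsub>C\<^esub> e a"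
    then have "\<Sqinter>\<^bsub>C\<^esub>(e ` K) \<sqsubseteq>\<^bsub>C\<^esub> e a"
      using above canonical_extension_inf_le_iff[OF K a] by blast
    from C.le_trans[OF le this] show "\<Sqinter>\<^bsub>C\<^esub>(e ` K') \<sqsubseteq>\<^bsub>C\<^esub> e a"
      using canonical_extension_inf_closed[OF K'] canonical_extension_inf_closed[OF K]
        canonical_extension_closed[OF a] .
  qed
  then show "K \<in> filters_below L C e u"
    using K by (simp add: filters_below_def)
next
  fix K assume "K \<in> filters_below L C e u"
  then have K: "K \<in> scott_open_filters L" and le: "\<Sqinter>\<^bsub>C\<^esub>(e ` K) \<sqsubseteq>\<^bsub>C\<^esub> u"
    by (auto simp: filters_below_def)
  have "a \<in> K" if a: "a \<in> carrier L" and ua: "u \<sqsubseteq>\<^bsub>C\<^esub> e a" for a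
    using C.le_trans[OF le ua canonical_extension_inf_closed[OF K] u canonical_extension_closed[OF a]]
      canonical_extension_inf_le_iff[OF K a] by blast
  then show "K \<in> polar_left (scott_open_filters L) (filter_incidence L) {a \<in> carrier L. u \<sqsubseteq>\<^bsub>C\<^esub> e a}"
    using K by (auto simp: polar_left_def)
qed

text \<open>The preimage of \<open>M\<close> is the join of the meets given by its members. That
  join lies below \<open>e a\<close> exactly when all members of \<open>M\<close> contain
  \<open>a\<close>, so the elements whose values lie above it form the right polar of
  \<open>M\<close>; \<open>polar_left_above\<close> and closedness of \<open>M\<close>
  finish.\<close>

lemma filters_below_surj:
  assumes M: "M \<in> carrier (filter_galois_lattice L)"
  shows "\<exists>u\<in>carrier C. filters_below L C e u = M"
proof
  let ?I = "(\<lambda>K. \<Sqinter>\<^bsub>C\<^esub>(e ` K)) ` M"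
  let ?u = "\<Squnion>\<^bsub>C\<^esub>?I"
  have MX: "M \<subseteq> scott_open_filters L"
    and cl: "polar_left (scott_open_filters L) (filter_incidence L)
               (polar_right (carrier L) (filter_incidence L) M) = M"
    using M by (auto simp: galois_lattice_def)
  have I: "?I \<subseteq> carrier C"
    using MX canonical_extension_inf_closed by blast
  show u: "?u \<in> carrier C"
    by (rule C.sup_closed[OF I])
  have "?u \<sqsubseteq>\<^bsub>C\<^esub> e a \<longleftrightarrow> (\<forall>K\<in>M. a \<in> K)" if a: "a \<in> carrier L" for a
  proof
    assume ua: "?u \<sqsubseteq>\<^bsub>C\<^esub> e a"
    show "\<forall>K\<in>M. a \<in> K"
    proof
      fix K assume "K \<in> M"
      then have K: "K \<in> scott_open_filters L" and "\<Sqinter>\<^bsub>C\<^esub>(e ` K) \<sqsubseteq>\<^bsub>C\<^esub> ?u"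
        using MX C.sup_upper[OF I] by blast+
      from C.le_trans[OF this(2) ua canonical_extension_inf_closed[OF K] u
          canonical_extension_closed[OF a]]
      show "a \<in> K"
        using canonical_extension_inf_le_iff[OF K a] by blast
    qed
  next
    assume "\<forall>K\<in>M. a \<in> K"
    then have "x \<sqsubseteq>\<^bsub>C\<^esub> e a" if "x \<in> ?I" for x
      using that MX canonical_extension_inf_le_iff[OF _ a] by blast
    then show "?u \<sqsubseteq>\<^bsub>C\<^esub> e a"
      by (rule C.sup_least[OF I canonical_extension_closed[OF a]])
  qed
  then have "{a \<in> carrier L. ?u \<sqsubseteq>\<^bsub>C\<^esub> e a} = polar_right (carrier L) (filter_incidence L) M"
    using MX by (auto simp: polar_right_def)
  then show "filters_below L C e ?u = M"
    using polar_left_above[OF u] cl by simp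
qed

lemma bij_betw_filters_below:
  "bij_betw (filters_below L C e) (carrier C) (carrier (filter_galois_lattice L))"
proof (rule bij_betw_imageI)
  show "inj_on (filters_below L C e) (carrier C)"
  proof (rule inj_onI)
    fix u v assume *: "u \<in> carrier C" "v \<in> carrier C" "filters_below L C e u = filters_below L C e v"
    then show "u = v"
      using filters_below_subset_iff[of u v] filters_below_subset_iff[of v u] by (intro C.le_antisym) auto
  qed
  \<comment> \<open>The two polar computations compose: the closure of a trace is the trace
    itself.\<close>
  have "filters_below L C e u \<in> carrier (filter_galois_lattice L)" if u: "u \<in> carrier C" for u
    using polar_right_filters_below[OF u] polar_left_above[OF u]
    by (simp add: galois_lattice_def) (simp add: filters_below_def)
  then show "filters_below L C e ` carrier C = carrier (filter_galois_lattice L)"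
    using filters_below_surj by blast
qed

lemma filters_below_iso:
  "complete_lattice_iso C (filter_galois_lattice L) (filters_below L C e)"
proof (rule complete_lattice_isoI[OF C.complete_lattice_axioms galois_lattice_complete
      bij_betw_filters_below])
  fix u v assume "u \<in> carrier C" "v \<in> carrier C"
  then show "filters_below L C e u \<sqsubseteq>\<^bsub>filter_galois_lattice L\<^esub> filters_below L C e v \<longleftrightarrow> u \<sqsubseteq>\<^bsub>C\<^esub> v"
    using filters_below_subset_iff by (simp add: galois_lattice_def)
qed

end

section \<open>Uniqueness and existence\<close>

lemma canonical_extension_unique:
  fixes L :: "('a, 'm) gorder_scheme"
  assumes C: "canonical_extension L C e" and C': "canonical_extension L C' e'"
  shows "\<exists>\<iota>. complete_lattice_iso C' C \<iota> \<and> (\<forall>a\<in>carrier L. \<iota> (e' a) = e a)"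
proof -
  let ?f = "filters_below L C e" and ?f' = "filters_below L C' e'"
  \<comment> \<open>Both extensions are represented in the same lattice
    \<open>filter_galois_lattice L\<close>, so one representation can be followed by the inverse of
    the other.\<close>
  let ?\<iota> = "inv_into (carrier C) ?f \<circ> ?f'"
  note bij = bij_betw_filters_below[OF C] and bij' = bij_betw_filters_below[OF C']
  have bij_\<iota>: "bij_betw ?\<iota> (carrier C') (carrier C)"
    by (rule bij_betw_trans[OF bij' bij_betw_inv_into[OF bij]])
  have \<iota>: "?\<iota> x \<in> carrier C" "?f (?\<iota> x) = ?f' x" if "x \<in> carrier C'" for x
    using bij_betw_apply[OF bij_\<iota> that] bij_betw_inv_into_right[OF bij bij_betw_apply[OF bij' that]]
    by auto
  have "complete_lattice_iso C' C ?\<iota>"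
  proof (rule complete_lattice_isoI[OF _ _ bij_\<iota>])
    show "complete_lattice C'" "complete_lattice C"
      using C C' by (auto simp: canonical_extension_def)
    fix x y assume "x \<in> carrier C'" "y \<in> carrier C'"
    then show "?\<iota> x \<sqsubseteq>\<^bsub>C\<^esub> ?\<iota> y \<longleftrightarrow> x \<sqsubseteq>\<^bsub>C'\<^esub> y"
      using filters_below_subset_iff[OF C \<iota>(1) \<iota>(1)] filters_below_subset_iff[OF C'] \<iota>(2) by metis
  qed
  \<comment> \<open>Both \<open>e a\<close> and \<open>e' a\<close> are represented by the set of
    filters containing \<open>a\<close>, which depends on \<open>L\<close> only.\<close>
  moreover have "?\<iota> (e' a) = e a" if a: "a \<in> carrier L" for a
    using bij_betw_inv_into_left[OF bij canonical_extension_closed[OF C a]]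
      filters_below_image[OF C a] filters_below_image[OF C' a] by simp
  ultimately show ?thesis by blast
qed

text \<open>The meet of the image of \<open>K\<close> is the set of Scott-open filters containing
  \<open>K\<close>. It has \<open>K\<close> itself as a member, and testing inequalities at that
  member yields both density and compactness.\<close>

lemma canonical_extension_exists:
  assumes L: "weak_partial_order L"
  shows "canonical_extension L (filter_galois_lattice L) (\<lambda>a. {K \<in> scott_open_filters L. a \<in> K})"
proof -
  let ?X = "scott_open_filters L" and ?Z = "filter_incidence L" and ?G = "filter_galois_lattice L"
  let ?e = "\<lambda>a. {K \<in> ?X. a \<in> K}"
  interpret G: complete_lattice ?G
    by (rule galois_lattice_complete)
  have le: "le ?G = (\<subseteq>)"
    by (simp add: galois_lattice_def)
  \<comment> \<open>Left polars are always Galois closed; the value at \<open>a\<close> is the left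
    polar of \<open>{a}\<close>.\<close>
  have closed: "polar_left ?X ?Z N \<in> carrier ?G" if "N \<subseteq> carrier L" for N
    using that unfolding galois_lattice_def polar_left_def polar_right_def by auto
  have e: "?e a \<in> carrier ?G" if a: "a \<in> carrier L" for a
    using closed[of "{a}"] a by (simp add: polar_left_def)
  have eK: "?e ` K \<subseteq> carrier ?G" if "K \<in> ?X" for K
    using e scott_open_filters_carrier[OF that] by blast
  \<comment> \<open>In the reverse inclusion order on filters this is the principal downset of
    \<open>K\<close>, obtained here as the left polar of \<open>K\<close>.\<close>
  have inf: "\<Sqinter>\<^bsub>?G\<^esub>(?e ` K) = {K' \<in> ?X. K \<subseteq> K'}" if K: "K \<in> ?X" for K
  proof (rule G.le_antisym)
    have "polar_left ?X ?Z K = {K' \<in> ?X. K \<subseteq> K'}"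
      using scott_open_filters_carrier[OF K] by (auto simp: polar_left_def)
    then show car: "{K' \<in> ?X. K \<subseteq> K'} \<in> carrier ?G"
      using closed[OF scott_open_filters_carrier[OF K]] by simp
    show infcar: "\<Sqinter>\<^bsub>?G\<^esub>(?e ` K) \<in> carrier ?G"
      by (rule G.inf_closed[OF eK[OF K]])
    have "\<Sqinter>\<^bsub>?G\<^esub>(?e ` K) \<subseteq> ?e a" if "a \<in> K" for a
      using G.inf_lower[OF eK[OF K], of "?e a"] that by (simp add: le)
    moreover have "\<Sqinter>\<^bsub>?G\<^esub>(?e ` K) \<subseteq> ?X"
      using infcar by (simp add: galois_lattice_def)
    ultimately show "\<Sqinter>\<^bsub>?G\<^esub>(?e ` K) \<sqsubseteq>\<^bsub>?G\<^esub> {K' \<in> ?X. K \<subseteq> K'}"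
      unfolding le by blast
    show "{K' \<in> ?X. K \<subseteq> K'} \<sqsubseteq>\<^bsub>?G\<^esub> \<Sqinter>\<^bsub>?G\<^esub>(?e ` K)"
      by (rule G.inf_greatest[OF eK[OF K] car]) (auto simp: le)
  qed
  have dense: "u \<sqsubseteq>\<^bsub>?G\<^esub> v"
    if u: "u \<in> carrier ?G" and v: "v \<in> carrier ?G"
      and *: "\<forall>K\<in>?X. \<forall>a\<in>carrier L.
        \<Sqinter>\<^bsub>?G\<^esub>(?e ` K) \<sqsubseteq>\<^bsub>?G\<^esub> u \<and> v \<sqsubseteq>\<^bsub>?G\<^esub> ?e a \<longrightarrow> \<Sqinter>\<^bsub>?G\<^esub>(?e ` K) \<sqsubseteq>\<^bsub>?G\<^esub> ?e a" for u v
    unfolding le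
  proof
    fix K assume Ku: "K \<in> u"
    have uX: "u \<subseteq> ?X" and ucl: "polar_left ?X ?Z (polar_right (carrier L) ?Z u) = u"
      and vX: "v \<subseteq> ?X" and vcl: "polar_left ?X ?Z (polar_right (carrier L) ?Z v) = v"
      using u v by (auto simp: galois_lattice_def)
    have K: "K \<in> ?X"
      using Ku uX by blast
    \<comment> \<open>Galois closed sets are upward closed under inclusion of filters: every
      \<open>a\<close> in the right polar of \<open>u\<close> lies in \<open>K\<close>, hence in
      each larger \<open>K'\<close>.\<close>
    have "{K' \<in> ?X. K \<subseteq> K'} \<subseteq> polar_left ?X ?Z (polar_right (carrier L) ?Z u)"
      using Ku by (auto simp: polar_left_def polar_right_def)
    then have Ku': "\<Sqinter>\<^bsub>?G\<^esub>(?e ` K) \<sqsubseteq>\<^bsub>?G\<^esub> u"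
      using ucl inf[OF K] by (simp add: le)
    \<comment> \<open>Elements of the right polar of \<open>v\<close> are those whose value lies
      above \<open>v\<close>, so the density hypothesis applies to them; evaluating the resulting
      inclusion at \<open>K\<close> gives membership.\<close>
    have "a \<in> K" if a: "a \<in> polar_right (carrier L) ?Z v" for a
    proof -
      have "a \<in> carrier L" "v \<sqsubseteq>\<^bsub>?G\<^esub> ?e a"
        using a vX by (auto simp: le polar_right_def)
      then have "\<Sqinter>\<^bsub>?G\<^esub>(?e ` K) \<sqsubseteq>\<^bsub>?G\<^esub> ?e a"
        using * K Ku' by blast
      then show "a \<in> K"
        unfolding le inf[OF K] using K by blast
    qed
    then have "K \<in> polar_left ?X ?Z (polar_right (carrier L) ?Z v)"
      using K by (auto simp: polar_left_def polar_right_def)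
    then show "K \<in> v"
      using vcl by simp
  qed
  have compact: "a \<in> K" if "K \<in> ?X" "\<Sqinter>\<^bsub>?G\<^esub>(?e ` K) \<sqsubseteq>\<^bsub>?G\<^esub> ?e a" for K a
    using that(2) unfolding le inf[OF that(1)] using that(1) by blast
  \<comment> \<open>The predicate \<open>isotone\<close> also demands that its source be a weak
    partial order, supplied by the assumption on \<open>L\<close>; monotonicity itself holds because
    filters are upsets.\<close>
  have "isotone L ?G ?e"
    by (rule isotoneI[OF L G.weak_partial_order_axioms])
      (auto simp: le intro: scott_open_filters_upset)
  then show ?thesis
    unfolding canonical_extension_def
    using G.complete_lattice_axioms e dense compact by (intro conjI) blast+
qed

theorem theorem4p2:
  fixes L :: "('a, 'm) gorder_scheme"
  assumes "frame L"
  shows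
    "(\<exists>(C :: 'a set set gorder) e. canonical_extension L C e) \<and>
     (\<forall>(C :: ('c, 'n) gorder_scheme) (C' :: ('d, 'k) gorder_scheme) e e'.
        canonical_extension L C e \<and> canonical_extension L C' e' \<longrightarrow>
        (\<exists>\<iota>. complete_lattice_iso C' C \<iota> \<and> (\<forall>a\<in>carrier L. \<iota> (e' a) = e a))) \<and>
     (\<forall>(C :: ('c, 'n) gorder_scheme) e.
        canonical_extension L C e \<longrightarrow>
        (\<exists>\<phi>. complete_lattice_iso C
               (galois_lattice (scott_open_filters L) (carrier L)
                  {(\<kappa>, a). \<kappa> \<in> scott_open_filters L \<and> a \<in> carrier L \<and> a \<in> \<kappa>}) \<phi>))"
proof (intro conjI allI impI)
  interpret frame L by fact
  show "\<exists>(C :: 'a set set gorder) e. canonical_extension L C e"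
    using canonical_extension_exists[OF weak_partial_order_axioms] by blast
next
  fix C :: "('c, 'n) gorder_scheme" and C' :: "('d, 'k) gorder_scheme" and e e'
  assume "canonical_extension L C e \<and> canonical_extension L C' e'"
  then show "\<exists>\<iota>. complete_lattice_iso C' C \<iota> \<and> (\<forall>a\<in>carrier L. \<iota> (e' a) = e a)"
    by (elim conjE) (rule canonical_extension_unique)
next
  fix C :: "('c, 'n) gorder_scheme" and e
  assume "canonical_extension L C e"
  then show "\<exists>\<phi>. complete_lattice_iso C (filter_galois_lattice L) \<phi>"
    by (intro exI) (rule filters_below_iso)
qed

end
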